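(* For every $C_0>0$ there exist $h_0>0$ and $C>0$ such that for all $h\in(0,h_0)$ and every eigenpair $(\lambda,\psi)$ of $\mathfrak{H}_h$ with $\lambda\leq-1+C_0h^{2/3}$, $$\int_{\mathbb{R}^2}|\psi-\Pi_0\psi|^2\,\mathrm{d}x\,\mathrm{d}y\leq Ch^{2/3}\|\psi\|^2,$$ where $\Pi_0\psi(x,y)=\Big(\int_{\mathbb{R}}\psi(x,y')e^{-|y'|}\,\mathrm{d}y'\Big)e^{-|y|}$.
   Context: For $h>0$ let $\mathfrak{Q}_h(\psi)=\int_{\mathbb{R}^2}h^2|\partial_x\psi|^2+|\partial_y\psi|^2\,\mathrm{d}x\,\mathrm{d}y-\int_{\mathbb{R}}|\psi(|s|,s)|^2\,\mathrm{d}s$ on $H^1(\mathbb{R}^2)$ (trace sense) and $\mathfrak{H}_h$ the associated self-adjoint operator on $L^2(\mathbb{R}^2)$. $\|\cdot\|$ is the $L^2(\mathbb{R}^2)$ norm. *)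

theory Defs
  imports "HOL-Analysis.Analysis"
begin

type_synonym fn2 = "real \<times> real \<Rightarrow> complex"

definition L2 :: "fn2 \<Rightarrow> bool" where
  "L2 f \<longleftrightarrow> f \<in> borel_measurable lborel \<and> integrable lborel (\<lambda>z. (cmod (f z))\<^sup>2)"

definition L2sq :: "fn2 \<Rightarrow> real" where
  "L2sq f = (\<integral>z. (cmod (f z))\<^sup>2 \<partial>lborel)"

definition Cc1 :: "fn2 \<Rightarrow> (real \<times> real \<Rightarrow> real \<times> real \<Rightarrow> complex) \<Rightarrow> bool" where
  "Cc1 \<phi> D \<longleftrightarrow> (\<forall>z. (\<phi> has_derivative D z) (at z))
     \<and> continuous_on UNIV (\<lambda>z. D z (1,0)) \<and> continuous_on UNIV (\<lambda>z. D z (0,1))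
     \<and> bounded {z. \<phi> z \<noteq> 0}"

text \<open>H1(R^2) as the completion of compactly supported C^1 functions:
  psi in H1 with weak derivatives gx, gy and trace t on the curve {(|s|,s)} iff
  there is an approximating sequence of Cc1 functions converging in H1 whose
  restrictions to the curve converge to t in L2(R).\<close>
definition H1_data :: "fn2 \<Rightarrow> fn2 \<Rightarrow> fn2 \<Rightarrow> (real \<Rightarrow> complex) \<Rightarrow> bool" where
  "H1_data \<psi> gx gy t \<longleftrightarrow> L2 \<psi> \<and> L2 gx \<and> L2 gy \<and>
     t \<in> borel_measurable lborel \<and> integrable lborel (\<lambda>s. (cmod (t s))\<^sup>2) \<and>
     (\<exists>\<phi> D. (\<forall>n. Cc1 (\<phi> n) (D n)) \<and>
        (\<lambda>n. L2sq (\<lambda>z. \<phi> n z - \<psi> z)) \<longlonglongrightarrow> 0 \<and>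
        (\<lambda>n. L2sq (\<lambda>z. D n z (1,0) - gx z)) \<longlonglongrightarrow> 0 \<and>
        (\<lambda>n. L2sq (\<lambda>z. D n z (0,1) - gy z)) \<longlonglongrightarrow> 0 \<and>
        (\<lambda>n. \<integral>s. (cmod (\<phi> n (\<bar>s\<bar>, s) - t s))\<^sup>2 \<partial>lborel) \<longlonglongrightarrow> 0)"

definition H1 :: "fn2 \<Rightarrow> bool" where
  "H1 \<psi> \<longleftrightarrow> (\<exists>gx gy t. H1_data \<psi> gx gy t)"

text \<open>Eigenpair of the operator H_h associated with the closed form Q_h:
  psi in the form domain, psi nonzero in L2, and Q_h(psi, phi) = lambda <psi, phi>
  for all phi in the form domain (this is the definition of the associated operator).\<close>
definition eigenpair :: "real \<Rightarrow> real \<Rightarrow> fn2 \<Rightarrow> bool" where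
  "eigenpair h E \<psi> \<longleftrightarrow>
     (\<exists>gx gy t. H1_data \<psi> gx gy t \<and> L2sq \<psi> \<noteq> 0 \<and>
       (\<forall>\<phi> fx fy u. H1_data \<phi> fx fy u \<longrightarrow>
          complex_of_real (h\<^sup>2) * (\<integral>z. gx z * cnj (fx z) \<partial>lborel)
          + (\<integral>z. gy z * cnj (fy z) \<partial>lborel)
          - (\<integral>s. t s * cnj (u s) \<partial>lborel)
          = complex_of_real E * (\<integral>z. \<psi> z * cnj (\<phi> z) \<partial>lborel)))"

definition Pi0 :: "fn2 \<Rightarrow> fn2" where
  "Pi0 \<psi> = (\<lambda>(x,y). (\<integral>y'. \<psi> (x,y') * complex_of_real (exp (- \<bar>y'\<bar>)) \<partial>lborel)
                     * complex_of_real (exp (- \<bar>y\<bar>)))"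

end

theory Submission
  imports Defs
begin

text \<open>
  Testing the eigenvalue equation with \<open>\<psi>\<close> itself gives \<open>Q\<^sub>h(\<psi>) = E \<parallel>\<psi>\<parallel>\<^sup>2\<close>, so after dropping the
  \<open>x\<close>-derivative it suffices to bound, fibrewise and uniformly in \<open>x\<close>, the defect
  \<open>\<parallel>f - \<Pi>\<^sub>0 f\<parallel>\<^sup>2\<close> of a slice \<open>f = \<psi>(x, \<cdot>)\<close> by a multiple of
  \<open>N(f) - |f(x)|\<^sup>2 - |f(-x)|\<^sup>2\<close>, where \<open>N(f) = \<parallel>f'\<parallel>\<^sup>2 + \<parallel>f\<parallel>\<^sup>2\<close> (traces only for \<open>x \<ge> 0\<close>).
  On a half line, integrating \<open>\<plusminus>(|f|\<^sup>2)' \<le> |f'|\<^sup>2 + |f|\<^sup>2\<close> over \<open>[0, x]\<close> and \<open>[x, \<infinity>)\<close> gives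
  \<open>2 |f(x)|\<^sup>2 \<le> |f(0)|\<^sup>2 + N(f)\<close>, while \<open>r = f - f(0) e\<^sup>-\<^sup>y\<close> satisfies \<open>r' + r = f' + f\<close> and \<open>r(0) = 0\<close>,
  whence \<open>\<parallel>r\<parallel>\<^sup>2 \<le> N(r) = N(f) - |f(0)|\<^sup>2\<close>. Adding these removes \<open>f(0)\<close>, and \<open>\<Pi>\<^sub>0 f\<close> is the
  best approximation of \<open>f\<close> by multiples of \<open>e\<^sup>-\<^sup>|\<^sup>y\<^sup>|\<close>.
\<close>

section \<open>Trace inequality with remainder in one variable\<close>

text \<open>The two closed half lines overlap only in the null set \<open>{0}\<close>, and the left
  one is reflected onto the right one. This reduces the line to the half line, and later folds the
  parameter \<open>s\<close> of the curve onto the slices with \<open>x\<close> nonnegative.\<close>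

lemma nn_integral_lborel_split_reflect:
  fixes F :: "real \<Rightarrow> ennreal"
  assumes [measurable]: "F \<in> borel_measurable borel"
  shows "(\<integral>\<^sup>+y. F y \<partial>lborel) =
    (\<integral>\<^sup>+y. F y * indicator {0..} y \<partial>lborel) + (\<integral>\<^sup>+y. F (- y) * indicator {0..} y \<partial>lborel)"
proof -
  have "(\<integral>\<^sup>+y. F y * indicator {..0} y \<partial>lborel)
      = (\<integral>\<^sup>+y. F (- y) * indicator {..0} (- y) \<partial>lborel)"
    by (subst nn_integral_real_affine[of _ "-1" 0]) auto
  also have "\<dots> = (\<integral>\<^sup>+y. F (- y) * indicator {0..} y \<partial>lborel)"
    by (intro nn_integral_cong) (auto simp: indicator_def)
  finally have "(\<integral>\<^sup>+y. F y * indicator {0..} y \<partial>lborel) + (\<integral>\<^sup>+y. F (- y) * indicator {0..} y \<partial>lborel)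
      = (\<integral>\<^sup>+y. F y * indicator {0..} y + F y * indicator {..0} y \<partial>lborel)"
    by (subst nn_integral_add) auto
  also have "\<dots> = (\<integral>\<^sup>+y. F y \<partial>lborel)"
    by (intro nn_integral_cong_AE AE_I[of _ _ "{0}"]) (auto simp: indicator_def)
  finally show ?thesis by simp
qed

lemma has_vector_derivative_norm_square:
  fixes g :: "real \<Rightarrow> complex"
  assumes "(g has_vector_derivative g') (at y within S)"
  shows "((\<lambda>y. (norm (g y))\<^sup>2) has_vector_derivative 2 * (g y \<bullet> g')) (at y within S)"
proof -
  have "((\<lambda>y. g y \<bullet> g y) has_vector_derivative (g y \<bullet> g' + g' \<bullet> g y)) (at y within S)"
    using bounded_bilinear.has_vector_derivative[OF bounded_bilinear_inner assms assms] .
  then show ?thesis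
    by (simp add: power2_norm_eq_inner inner_commute)
qed

text \<open>Sum of three bounds: \<open>1\<close> and \<open>2\<close> control the square of
  \<open>g x\<close> by the energy to the left and to the right of \<open>x\<close>, and
  \<open>4\<close> controls the remainder \<open>r\<close>. The square of \<open>g 0\<close> enters
  \<open>1\<close> and \<open>4\<close> with opposite signs and cancels, while the total energy is
  used twice.\<close>

lemma Icc_trace_bound:
  fixes g g' :: "real \<Rightarrow> complex"
  assumes der: "\<And>y. (g has_vector_derivative g' y) (at y)"
    and cont: "continuous_on UNIV g'"
    and x: "0 \<le> x" "x \<le> T" and gT: "g T = 0"
  shows "integral {0..T} (\<lambda>y. (norm (g y - g 0 * complex_of_real (exp (- y))))\<^sup>2) + 2 * (norm (g x))\<^sup>2
     \<le> 2 * integral {0..T} (\<lambda>y. (norm (g' y))\<^sup>2 + (norm (g y))\<^sup>2)"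
proof -
  have contg: "continuous_on S g" for S
    using der by (meson continuous_at_imp_continuous_on has_vector_derivative_continuous)
  have contg': "continuous_on S g'" for S
    using cont continuous_on_subset by blast
  define w where "w = (\<lambda>y. (norm (g' y))\<^sup>2 + (norm (g y))\<^sup>2)"
  define r where "r = (\<lambda>y. g y - g 0 * complex_of_real (exp (- y)))"
  define r' where "r' = (\<lambda>y. g' y + g 0 * complex_of_real (exp (- y)))"
  have wi: "w integrable_on {a..b}" for a b
    unfolding w_def by (intro integrable_continuous_interval continuous_intros contg contg')
  have ri: "(\<lambda>y. (norm (r y))\<^sup>2) integrable_on {a..b}" for a b
    unfolding r_def by (intro integrable_continuous_interval continuous_intros contg)
  have derr: "(r has_vector_derivative r' y) (at y within S)" for y S
    unfolding r_def r'_def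
    by (auto intro!: derivative_eq_intros has_vector_derivative_at_within[OF der])
  have dg: "((\<lambda>y. (norm (g y))\<^sup>2) has_vector_derivative 2 * (g y \<bullet> g' y)) (at y within S)" for y S
    by (intro has_vector_derivative_norm_square has_vector_derivative_at_within[OF der])
  have dr: "((\<lambda>y. (norm (r y))\<^sup>2) has_vector_derivative 2 * (r y \<bullet> r' y)) (at y within S)" for y S
    by (intro has_vector_derivative_norm_square derr)
  have Ig: "((\<lambda>y. 2 * (g y \<bullet> g' y)) has_integral ((norm (g b))\<^sup>2 - (norm (g a))\<^sup>2)) {a..b}" if "a \<le> b" for a b
    by (rule fundamental_theorem_of_calculus[OF that dg])
  have Ir: "((\<lambda>y. 2 * (r y \<bullet> r' y)) has_integral ((norm (r b))\<^sup>2 - (norm (r a))\<^sup>2)) {a..b}" if "a \<le> b" for a b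
    by (rule fundamental_theorem_of_calculus[OF that dr])
  have Iw: "(w has_integral integral {a..b} w) {a..b}" for a b
    using wi by (rule integrable_integral)
  \<comment> \<open>The first sign serves \<open>1\<close>, on the interval left of
    \<open>x\<close>; the second serves \<open>2\<close>, on the interval right of
    \<open>x\<close>.\<close>
  have inner_bound: "2 * (a \<bullet> b) \<le> (norm b)\<^sup>2 + (norm a)\<^sup>2"
    "- (2 * (a \<bullet> b)) \<le> (norm b)\<^sup>2 + (norm a)\<^sup>2" for a b :: complex
    using inner_ge_zero[of "a - b"] inner_ge_zero[of "a + b"]
    by (simp_all add: power2_norm_eq_inner inner_diff inner_add inner_commute)
  have T: "0 \<le> T" using x by simp
  have 1: "(norm (g x))\<^sup>2 - (norm (g 0))\<^sup>2 \<le> integral {0..x} w"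
    by (rule has_integral_le[OF Ig[OF x(1)] Iw]) (use inner_bound in \<open>auto simp: w_def\<close>)
  have 2: "- ((norm (g T))\<^sup>2 - (norm (g x))\<^sup>2) \<le> integral {x..T} w"
    by (rule has_integral_le[OF has_integral_neg[OF Ig[OF x(2)]] Iw])
      (use inner_bound in \<open>auto simp: w_def\<close>)
  have 3: "integral {0..x} w + integral {x..T} w = integral {0..T} w"
    by (intro Henstock_Kurzweil_Integration.integral_combine x wi)
  \<comment> \<open>Since \<open>exp (- y)\<close> solves u' + u = 0, the sums \<open>r + r'\<close>
    and \<open>g + g'\<close> agree. Squaring both and discarding the square of \<open>r'\<close>
    leaves cross terms that are exact derivatives, so \<open>4\<close> follows by
    integration.\<close>
  have pw: "(norm (r y))\<^sup>2 \<le> w y + 2 * (g y \<bullet> g' y) - 2 * (r y \<bullet> r' y)" for y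
  proof -
    have "r y + r' y = g y + g' y" by (simp add: r_def r'_def)
    then have "(r y + r' y) \<bullet> (r y + r' y) = (g y + g' y) \<bullet> (g y + g' y)" by simp
    then have "r y \<bullet> r y + 2 * (r y \<bullet> r' y) + r' y \<bullet> r' y = g y \<bullet> g y + 2 * (g y \<bullet> g' y) + g' y \<bullet> g' y"
      by (simp add: inner_add inner_commute)
    moreover have "0 \<le> r' y \<bullet> r' y" by simp
    ultimately show ?thesis
      unfolding w_def power2_norm_eq_inner by linarith
  qed
  have 4: "integral {0..T} (\<lambda>y. (norm (r y))\<^sup>2)
     \<le> integral {0..T} w + ((norm (g T))\<^sup>2 - (norm (g 0))\<^sup>2) - ((norm (r T))\<^sup>2 - (norm (r 0))\<^sup>2)"
    by (rule has_integral_le[OF integrable_integral[OF ri]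
          has_integral_diff[OF has_integral_add[OF Iw Ig[OF T]] Ir[OF T]]]) (rule pw)
  \<comment> \<open>Of the four boundary terms in \<open>4\<close>, those from \<open>r 0\<close>
    and \<open>g T\<close> vanish and the one from \<open>r T\<close> has a favourable sign; only
    the negative term from \<open>g 0\<close> remains.\<close>
  have "(norm (r 0))\<^sup>2 = 0" "(norm (g T))\<^sup>2 = 0" by (simp_all add: r_def gT)
  moreover have "(norm (r T))\<^sup>2 \<ge> 0" by simp
  ultimately have "integral {0..T} (\<lambda>y. (norm (r y))\<^sup>2) + 2 * (norm (g x))\<^sup>2 \<le> 2 * integral {0..T} w"
    using 1 2 3 4 by linarith
  then show ?thesis by (simp add: r_def w_def)
qed

text \<open>Beyond \<open>R\<close> the remainder is a multiple of \<open>exp (- y)\<close>, which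
  never vanishes unless \<open>g 0\<close> does, so the half line is reached by a limit of intervals
  \<open>{0..T}\<close>. The integral on the left increases with \<open>T\<close>, while the bound
  on the right is already independent of \<open>T\<close>.\<close>

lemma halfline_trace_bound:
  fixes g g' :: "real \<Rightarrow> complex"
  assumes der: "\<And>y. (g has_vector_derivative g' y) (at y)"
    and cont: "continuous_on UNIV g'"
    and x: "0 \<le> x" and supp: "\<And>y. y \<ge> R \<Longrightarrow> g y = 0"
  shows "(\<integral>\<^sup>+y. ennreal ((norm (g y - g 0 * complex_of_real (exp (- y))))\<^sup>2) * indicator {0..} y \<partial>lborel)
      + ennreal (2 * (norm (g x))\<^sup>2)
     \<le> 2 * (\<integral>\<^sup>+y. ennreal ((norm (g' y))\<^sup>2 + (norm (g y))\<^sup>2) * indicator {0..} y \<partial>lborel)"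
    (is "?A + _ \<le> 2 * ?B")
proof -
  have contg: "continuous_on S g" for S
    using der by (meson continuous_at_imp_continuous_on has_vector_derivative_continuous)
  have contg': "continuous_on S g'" for S
    using cont continuous_on_subset by blast
  have [measurable]: "g \<in> borel_measurable borel" "g' \<in> borel_measurable borel"
    using contg cont by (auto intro: borel_measurable_continuous_onI)
  define a where "a = (\<lambda>y. (norm (g y - g 0 * complex_of_real (exp (- y))))\<^sup>2)"
  define b where "b = (\<lambda>y. (norm (g' y))\<^sup>2 + (norm (g y))\<^sup>2)"
  have [measurable]: "a \<in> borel_measurable borel" by (simp add: a_def)
  have ia: "a integrable_on {0..T}" and ib: "b integrable_on {0..T}" for T
    unfolding a_def b_def
    by (intro integrable_continuous_interval continuous_intros contg contg')+
  have nn_Icc: "(\<integral>\<^sup>+y. ennreal (f y) * indicator {0..T} y \<partial>lborel) = ennreal (integral {0..T} f)"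
    if "f integrable_on {0..T}" "\<And>y. 0 \<le> f y" for f T
  proof -
    have "(\<integral>\<^sup>+y. ennreal (indicator {0..T} y * f y) \<partial>lborel) = ennreal (integral {0..T} f)"
      by (rule nn_integral_has_integral_lebesgue[OF _ integrable_integral[OF that(1)]]) (rule that(2))
    moreover have "ennreal (indicator {0..T} y * f y) = ennreal (f y) * indicator {0..T} y" for y
      by (auto simp: indicator_def)
    ultimately show ?thesis by simp
  qed
  have nonneg: "0 \<le> a y" "0 \<le> b y" for y by (auto simp: a_def b_def)
  \<comment> \<open>The two conditions on \<open>T\<close> put \<open>x\<close> into the interval
    and make \<open>g T\<close> vanish.\<close>
  have fin: "(\<integral>\<^sup>+y. ennreal (a y) * indicator {0..T} y \<partial>lborel) + ennreal (2 * (norm (g x))\<^sup>2) \<le> 2 * ?B"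
    if T: "x \<le> T" "R \<le> T" for T
  proof -
    have nni: "integral {0..T} a \<ge> 0" "integral {0..T} b \<ge> 0"
      using nonneg by (auto intro!: Henstock_Kurzweil_Integration.integral_nonneg ia ib)
    have "integral {0..T} a + 2 * (norm (g x))\<^sup>2 \<le> 2 * integral {0..T} b"
      unfolding a_def b_def by (rule Icc_trace_bound[OF der cont x T(1) supp[OF T(2)]])
    then have "ennreal (integral {0..T} a) + ennreal (2 * (norm (g x))\<^sup>2) \<le> 2 * ennreal (integral {0..T} b)"
      using nni by (simp flip: ennreal_plus ennreal_numeral ennreal_mult)
    also have "ennreal (integral {0..T} b) \<le> ?B"
      unfolding nn_Icc[OF ib nonneg(2), symmetric]
      by (intro nn_integral_mono) (auto simp: b_def indicator_def)
    finally show ?thesis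
      unfolding nn_Icc[OF ia nonneg(1)] by (simp add: mult_left_mono)
  qed
  have "(\<lambda>n::nat. \<integral>\<^sup>+y. ennreal (a y) * indicator {0..real n} y \<partial>lborel)
      \<longlonglongrightarrow> (\<integral>\<^sup>+y. ennreal (a y) * indicator {0..} y \<partial>lborel)"
  proof (rule nn_integral_LIMSEQ)
    show "incseq (\<lambda>(n::nat) y. ennreal (a y) * indicator {0..real n} y)"
      by (auto simp: incseq_def le_fun_def indicator_def)
    fix y :: real
    obtain N :: nat where N: "y \<le> real N" using real_arch_simple by blast
    have "\<forall>\<^sub>F n::nat in sequentially. ennreal (a y) * indicator {0..real n} y = ennreal (a y) * indicator {0..} y"
      using eventually_ge_at_top[of N] by eventually_elim (use N in \<open>auto simp: indicator_def\<close>)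
    then show "(\<lambda>n::nat. ennreal (a y) * indicator {0..real n} y) \<longlonglongrightarrow> ennreal (a y) * indicator {0..} y"
      by (rule tendsto_eventually)
  qed auto
  then have "(\<lambda>n::nat. (\<integral>\<^sup>+y. ennreal (a y) * indicator {0..real n} y \<partial>lborel) + ennreal (2 * (norm (g x))\<^sup>2))
      \<longlonglongrightarrow> (\<integral>\<^sup>+y. ennreal (a y) * indicator {0..} y \<partial>lborel) + ennreal (2 * (norm (g x))\<^sup>2)"
    by (intro tendsto_add tendsto_const)
  then have "(\<integral>\<^sup>+y. ennreal (a y) * indicator {0..} y \<partial>lborel) + ennreal (2 * (norm (g x))\<^sup>2) \<le> 2 * ?B"
  proof (rule LIMSEQ_le_const2)
    obtain N :: nat where N: "max x R \<le> real N" using real_arch_simple by blast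
    show "\<exists>N. \<forall>n\<ge>N. (\<integral>\<^sup>+y. ennreal (a y) * indicator {0..real n} y \<partial>lborel) + ennreal (2 * (norm (g x))\<^sup>2) \<le> 2 * ?B"
      using N by (intro exI[of _ N] allI impI fin) auto
  qed
  then show ?thesis by (simp add: a_def)
qed

text \<open>For \<open>x\<close> nonnegative the vertical line through \<open>x\<close> meets the
  curve at heights \<open>x\<close> and \<open>- x\<close>. The half-line bound is applied to
  \<open>g\<close> and to its reflection; both have the same value at \<open>0\<close>, so a single
  multiple of the profile serves both halves. For negative \<open>x\<close> the line misses the
  curve and comparison with zero suffices.\<close>

lemma line_trace_bound:
  fixes g g' :: "real \<Rightarrow> complex"
  assumes der: "\<And>y. (g has_vector_derivative g' y) (at y)"
    and cont: "continuous_on UNIV g'"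
    and supp: "\<And>y. \<bar>y\<bar> \<ge> R \<Longrightarrow> g y = 0"
  shows "(\<integral>\<^sup>+y. ennreal ((norm (g y - (if 0 \<le> x then g 0 else 0) * complex_of_real (exp (- \<bar>y\<bar>))))\<^sup>2) \<partial>lborel)
      + ennreal (2 * (norm (g x))\<^sup>2 + 2 * (norm (g (- x)))\<^sup>2) * indicator {0..} x
     \<le> 2 * (\<integral>\<^sup>+y. ennreal ((norm (g' y))\<^sup>2 + (norm (g y))\<^sup>2) \<partial>lborel)"
proof -
  have contg: "continuous_on S g" for S
    using der by (meson continuous_at_imp_continuous_on has_vector_derivative_continuous)
  have [measurable]: "g \<in> borel_measurable borel" "g' \<in> borel_measurable borel"
    using contg cont by (auto intro: borel_measurable_continuous_onI)
  let ?w = "\<lambda>y. ennreal ((norm (g' y))\<^sup>2 + (norm (g y))\<^sup>2)"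
  let ?r = "\<lambda>y. ennreal ((norm (g y - g 0 * complex_of_real (exp (- \<bar>y\<bar>))))\<^sup>2)"
  show ?thesis
  proof (cases "0 \<le> x")
    case False
    have "(\<integral>\<^sup>+y. ennreal ((norm (g y))\<^sup>2) \<partial>lborel) \<le> 1 * (\<integral>\<^sup>+y. ?w y \<partial>lborel)"
      by (auto intro!: nn_integral_mono)
    also have "\<dots> \<le> 2 * (\<integral>\<^sup>+y. ?w y \<partial>lborel)"
      by (intro mult_right_mono) auto
    finally show ?thesis using False by simp
  next
    case True
    have p: "(\<integral>\<^sup>+y. ?r y * indicator {0..} y \<partial>lborel) + ennreal (2 * (norm (g x))\<^sup>2)
        \<le> 2 * (\<integral>\<^sup>+y. ?w y * indicator {0..} y \<partial>lborel)"
    proof -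
      have "?r y * indicator {0..} y
          = ennreal ((norm (g y - g 0 * complex_of_real (exp (- y))))\<^sup>2) * indicator {0..} y" for y
        by (auto simp: indicator_def)
      then show ?thesis
        using halfline_trace_bound[OF der cont True, of R] supp by simp
    qed
    have m: "(\<integral>\<^sup>+y. ?r (-y) * indicator {0..} y \<partial>lborel) + ennreal (2 * (norm (g (-x)))\<^sup>2)
        \<le> 2 * (\<integral>\<^sup>+y. ?w (-y) * indicator {0..} y \<partial>lborel)"
    proof -
      have "((\<lambda>y. g (- y)) has_vector_derivative - g' (- y)) (at y)" for y
      proof -
        have "((g \<circ> uminus) has_vector_derivative (-1) *\<^sub>R g' (- y)) (at y)"
          by (rule vector_diff_chain_at) (auto intro!: derivative_eq_intros der)
        then show ?thesis by (simp add: o_def)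
      qed
      moreover have "continuous_on UNIV (\<lambda>y. - g' (- y))"
        by (intro continuous_intros continuous_on_compose2[OF cont]) auto
      \<comment> \<open>The form \<open>g (-0)\<close> matches the reflected function evaluated at
        \<open>0\<close> in the instance of \<open>halfline_trace_bound\<close> below.\<close>
      moreover have "?r (-y) * indicator {0..} y
          = ennreal ((norm (g (-y) - g (-0) * complex_of_real (exp (- y))))\<^sup>2) * indicator {0..} y" for y
        by (auto simp: indicator_def)
      ultimately show ?thesis
        using halfline_trace_bound[of "\<lambda>y. g (-y)" "\<lambda>y. - g' (-y)" x R] True supp by simp
    qed
    have "(\<integral>\<^sup>+y. ?r y \<partial>lborel) + (ennreal (2 * (norm (g x))\<^sup>2) + ennreal (2 * (norm (g (-x)))\<^sup>2))
        \<le> 2 * (\<integral>\<^sup>+y. ?w y \<partial>lborel)"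
      using add_mono[OF p m]
        nn_integral_lborel_split_reflect[of ?r] nn_integral_lborel_split_reflect[of ?w]
      by (simp add: algebra_simps)
    then show ?thesis using True by simp
  qed
qed

section \<open>The transverse profile and its orthogonal projection\<close>

text \<open>This unit normalisation makes pairing with the profile and multiplying back an
  orthogonal projection.\<close>

lemma has_bochner_integral_exp_abs_square:
  "has_bochner_integral lborel (\<lambda>y::real. (exp (- \<bar>y\<bar>))\<^sup>2) 1"
proof -
  \<comment> \<open>The limit is written \<open>- 0 / 2\<close> to follow the shape of the
    antiderivative.\<close>
  have lim: "((\<lambda>y::real. - exp (- 2 * y) / 2) \<longlongrightarrow> - 0 / 2) at_top"
    by (intro tendsto_intros filterlim_compose[OF exp_at_bot] filterlim_tendsto_neg_mult_at_bot[of _ "-2"])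
       (auto intro: filterlim_ident)
  have half: "(\<integral>\<^sup>+y. ennreal ((exp (- \<bar>y\<bar>))\<^sup>2) * indicator {0..} y \<partial>lborel) = ennreal (1/2)"
  proof -
    have "(\<integral>\<^sup>+y. ennreal ((exp (- \<bar>y\<bar>))\<^sup>2) * indicator {0..} y \<partial>lborel)
        = (\<integral>\<^sup>+y. ennreal (exp (- 2 * y)) * indicator {0..} y \<partial>lborel)"
      by (intro nn_integral_cong) (auto simp: indicator_def power2_eq_square simp flip: exp_add)
    also have "\<dots> = ennreal (0 - (- exp (- 2 * 0) / 2))"
      by (rule nn_integral_FTC_atLeast) (use lim in \<open>auto intro!: derivative_eq_intros\<close>)
    finally show ?thesis by simp
  qed
  have "(\<integral>\<^sup>+y. ennreal ((exp (- \<bar>y\<bar>))\<^sup>2) \<partial>lborel) = ennreal (1/2) + ennreal (1/2)"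
    by (subst nn_integral_lborel_split_reflect) (use half in simp_all)
  also have "\<dots> = ennreal 1" by (subst ennreal_plus[symmetric]) auto
  finally show ?thesis
    by (intro has_bochner_integral_nn_integral) auto
qed

text \<open>Pythagoras: with \<open>h\<close> the error for the coefficient \<open>c\<close> and
  \<open>b\<close> its component along \<open>e\<close>, the projection has coefficient
  \<open>b + c\<close> and its squared error is that of \<open>h\<close> minus the square of the
  norm of \<open>b\<close>. If the right-hand side is infinite the claim is trivial; otherwise
  \<open>h\<close> is square integrable, which makes \<open>f y * e y\<close> integrable.\<close>

lemma projection_minimizes:
  fixes f :: "real \<Rightarrow> complex" and c :: complex
  defines "e \<equiv> \<lambda>y::real. complex_of_real (exp (- \<bar>y\<bar>))"
  assumes [measurable]: "f \<in> borel_measurable borel"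
  shows "(\<integral>\<^sup>+y. ennreal ((norm (f y - (\<integral>y'. f y' * e y' \<partial>lborel) * e y))\<^sup>2) \<partial>lborel)
     \<le> (\<integral>\<^sup>+y. ennreal ((norm (f y - c * e y))\<^sup>2) \<partial>lborel)"
proof (cases "(\<integral>\<^sup>+y. ennreal ((norm (f y - c * e y))\<^sup>2) \<partial>lborel) = \<infinity>")
  case True then show ?thesis by simp
next
  case False
  define h where "h = (\<lambda>y. f y - c * e y)"
  have [measurable]: "e \<in> borel_measurable borel" by (simp add: e_def)
  have [measurable]: "h \<in> borel_measurable borel" by (simp add: h_def)
  have ih: "integrable lborel (\<lambda>y. (norm (h y))\<^sup>2)"
    using False by (intro integrableI_nonneg) (auto simp: h_def top.not_eq_extremum)
  have he: "has_bochner_integral lborel (\<lambda>y. (norm (e y))\<^sup>2) 1"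
    using has_bochner_integral_exp_abs_square by (simp add: e_def)
  have e2: "e y * e y = complex_of_real ((norm (e y))\<^sup>2)" for y
    by (simp add: e_def power2_eq_square)
  have hee: "has_bochner_integral lborel (\<lambda>y. e y * e y) 1"
    using has_bochner_integral_of_real[OF he, where 'a=complex] by (simp add: e2)
  have ihe: "integrable lborel (\<lambda>y. h y * e y)"
  proof (rule Bochner_Integration.integrable_bound)
    show "integrable lborel (\<lambda>y. (norm (h y))\<^sup>2 + (norm (e y))\<^sup>2)"
      using ih he by (auto simp: has_bochner_integral_iff)
    have "norm (h y * e y) \<le> (norm (h y))\<^sup>2 + (norm (e y))\<^sup>2" for y
    proof -
      have "2 * norm (h y) * norm (e y) \<le> (norm (h y))\<^sup>2 + (norm (e y))\<^sup>2"
        by (rule sum_squares_bound)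
      moreover have "0 \<le> norm (h y) * norm (e y)" by simp
      ultimately show ?thesis unfolding norm_mult by linarith
    qed
    then show "AE y in lborel. norm (h y * e y) \<le> norm ((norm (h y))\<^sup>2 + (norm (e y))\<^sup>2)"
      by auto
  qed auto
  define b where "b = (\<integral>y. h y * e y \<partial>lborel)"
  have "has_bochner_integral lborel (\<lambda>y. h y * e y + c * (e y * e y)) (b + c * 1)"
    unfolding b_def
    by (intro has_bochner_integral_add has_bochner_integral_integrable ihe
        has_bochner_integral_mult_right hee)
  then have proj: "(\<integral>y. f y * e y \<partial>lborel) = b + c"
    by (simp add: h_def algebra_simps has_bochner_integral_iff)
  have exp: "(norm (f y - (b + c) * e y))\<^sup>2
      = (norm (h y))\<^sup>2 - 2 * Re (cnj b * (h y * e y)) + (norm b)\<^sup>2 * (norm (e y))\<^sup>2" for y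
  proof -
    have "(norm (h y - b * e y))\<^sup>2
      = (norm (h y))\<^sup>2 - 2 * Re (cnj b * (h y * e y)) + (norm b)\<^sup>2 * (norm (e y))\<^sup>2"
      unfolding cmod_power2 by (simp add: e_def power2_eq_square algebra_simps)
    then show ?thesis by (simp add: h_def algebra_simps)
  qed
  have "has_bochner_integral lborel (\<lambda>y. (norm (h y))\<^sup>2 - 2 * Re (cnj b * (h y * e y)) + (norm b)\<^sup>2 * (norm (e y))\<^sup>2)
      ((\<integral>y. (norm (h y))\<^sup>2 \<partial>lborel) - 2 * Re (cnj b * b) + (norm b)\<^sup>2 * 1)"
    unfolding b_def
    by (intro has_bochner_integral_add has_bochner_integral_diff has_bochner_integral_Re
        has_bochner_integral_integrable ih ihe has_bochner_integral_mult_right he)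
  moreover have "X - 2 * Re (cnj b * b) + (norm b)\<^sup>2 * 1 = X - (norm b)\<^sup>2" for X
    unfolding cmod_power2 by (simp add: power2_eq_square)
  ultimately have hb: "has_bochner_integral lborel (\<lambda>y. (norm (f y - (b + c) * e y))\<^sup>2)
      ((\<integral>y. (norm (h y))\<^sup>2 \<partial>lborel) - (norm b)\<^sup>2)"
    by (simp only: exp)
  have "(\<integral>\<^sup>+y. ennreal ((norm (f y - (b + c) * e y))\<^sup>2) \<partial>lborel)
      = ennreal ((\<integral>y. (norm (h y))\<^sup>2 \<partial>lborel) - (norm b)\<^sup>2)"
    using hb nn_integral_eq_integral[of lborel "\<lambda>y. (norm (f y - (b + c) * e y))\<^sup>2"]
    by (simp add: has_bochner_integral_iff)
  also have "\<dots> \<le> ennreal (\<integral>y. (norm (h y))\<^sup>2 \<partial>lborel)"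
    by (intro ennreal_leI) simp
  also have "\<dots> = (\<integral>\<^sup>+y. ennreal ((norm (h y))\<^sup>2) \<partial>lborel)"
    using ih by (subst nn_integral_eq_integral) auto
  finally show ?thesis by (simp add: proj h_def)
qed

section \<open>Convergence of squared norms\<close>

text \<open>Young's inequality with weight \<open>e\<close>: the coefficient of the fixed function
  \<open>b\<close> can be made small at the price of a large coefficient on the distance, which
  tends to zero in the application.\<close>

lemma norm_square_diff_le:
  fixes a b :: complex
  assumes "0 < e"
  shows "\<bar>(norm a)\<^sup>2 - (norm b)\<^sup>2\<bar> \<le> e * (norm b)\<^sup>2 + (1 + 1 / e) * (norm (a - b))\<^sup>2"
proof -
  define d where "d = a - b"
  have a: "a = b + d" by (simp add: d_def)
  have *: "(norm a)\<^sup>2 - (norm b)\<^sup>2 = 2 * (b \<bullet> d) + (norm d)\<^sup>2"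
    by (simp add: a power2_norm_eq_inner inner_add inner_commute)
  have "\<bar>b \<bullet> d\<bar> \<le> norm b * norm d" by (rule Cauchy_Schwarz_ineq2)
  moreover have "2 * (norm b * norm d) \<le> e * (norm b)\<^sup>2 + (norm d)\<^sup>2 / e"
  proof -
    have "0 \<le> (e * norm b - norm d)\<^sup>2 / e" using assms by simp
    also have "\<dots> = e * (norm b)\<^sup>2 + (norm d)\<^sup>2 / e - 2 * (norm b * norm d)"
      using assms by (simp add: power2_eq_square field_simps)
    finally show ?thesis by simp
  qed
  moreover have "(1 + 1 / e) * (norm d)\<^sup>2 = (norm d)\<^sup>2 + (norm d)\<^sup>2 / e"
    by (simp add: algebra_simps)
  moreover have "0 \<le> (norm d)\<^sup>2" by simp
  ultimately show ?thesis unfolding * d_def[symmetric] by linarith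
qed

lemma norm_square_diff_le_double:
  fixes a b :: complex
  shows "(norm (a - b))\<^sup>2 \<le> 2 * (norm a)\<^sup>2 + 2 * (norm b)\<^sup>2"
  using inner_ge_zero[of "a + b"]
  by (simp add: power2_norm_eq_inner inner_add inner_diff inner_commute)

lemma integrable_norm_square_diff:
  fixes f g :: "'a \<Rightarrow> complex"
  assumes [measurable]: "f \<in> borel_measurable M" "g \<in> borel_measurable M"
    and "integrable M (\<lambda>x. (norm (f x))\<^sup>2)" "integrable M (\<lambda>x. (norm (g x))\<^sup>2)"
  shows "integrable M (\<lambda>x. (norm (f x - g x))\<^sup>2)"
proof (rule Bochner_Integration.integrable_bound)
  show "integrable M (\<lambda>x. 2 * (norm (f x))\<^sup>2 + 2 * (norm (g x))\<^sup>2)"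
    using assms by simp
  show "AE x in M. norm ((norm (f x - g x))\<^sup>2) \<le> norm (2 * (norm (f x))\<^sup>2 + 2 * (norm (g x))\<^sup>2)"
    using norm_square_diff_le_double by auto
qed simp

text \<open>The pointwise bound \<open>norm_square_diff_le\<close> is integrated with a fixed weight
  \<open>e\<close>; the term with \<open>G\<close> is then at most \<open>r / 2\<close>, and the
  distance term falls below \<open>r / 2\<close> eventually.\<close>

lemma tendsto_integral_norm_square:
  fixes f :: "nat \<Rightarrow> 'a \<Rightarrow> complex" and g :: "'a \<Rightarrow> complex"
  assumes [measurable]: "\<And>n. f n \<in> borel_measurable M" "g \<in> borel_measurable M"
    and fi: "\<And>n. integrable M (\<lambda>x. (norm (f n x))\<^sup>2)" and gi: "integrable M (\<lambda>x. (norm (g x))\<^sup>2)"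
    and lim: "(\<lambda>n. \<integral>x. (norm (f n x - g x))\<^sup>2 \<partial>M) \<longlonglongrightarrow> 0"
  shows "(\<lambda>n. \<integral>x. (norm (f n x))\<^sup>2 \<partial>M) \<longlonglongrightarrow> (\<integral>x. (norm (g x))\<^sup>2 \<partial>M)"
proof (rule LIMSEQ_I)
  fix r :: real assume r: "0 < r"
  define G where "G = (\<integral>x. (norm (g x))\<^sup>2 \<partial>M)"
  have G: "0 \<le> G" by (simp add: G_def)
  \<comment> \<open>The summand \<open>1\<close> keeps the denominator positive when
    \<open>G\<close> is zero.\<close>
  define e where "e = r / (2 * (G + 1))"
  have e: "0 < e" using r G by (simp add: e_def)
  have eG: "e * G \<le> r / 2" using r G by (simp add: e_def field_simps)
  have di: "integrable M (\<lambda>x. (norm (f n x - g x))\<^sup>2)" for n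
    by (intro integrable_norm_square_diff fi gi) auto
  have bound: "\<bar>(\<integral>x. (norm (f n x))\<^sup>2 \<partial>M) - G\<bar> \<le> e * G + (1 + 1 / e) * (\<integral>x. (norm (f n x - g x))\<^sup>2 \<partial>M)" for n
  proof -
    have "(\<integral>x. (norm (f n x))\<^sup>2 \<partial>M) - G = (\<integral>x. (norm (f n x))\<^sup>2 - (norm (g x))\<^sup>2 \<partial>M)"
      using fi gi by (simp add: G_def)
    also have "\<bar>\<dots>\<bar> \<le> (\<integral>x. \<bar>(norm (f n x))\<^sup>2 - (norm (g x))\<^sup>2\<bar> \<partial>M)"
      by (rule integral_abs_bound)
    also have "\<dots> \<le> (\<integral>x. e * (norm (g x))\<^sup>2 + (1 + 1 / e) * (norm (f n x - g x))\<^sup>2 \<partial>M)"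
      by (intro integral_mono norm_square_diff_le e integrable_abs Bochner_Integration.integrable_diff
          Bochner_Integration.integrable_add integrable_mult_right fi gi di)
    also have "\<dots> = e * G + (1 + 1 / e) * (\<integral>x. (norm (f n x - g x))\<^sup>2 \<partial>M)"
      using gi di by (simp add: G_def)
    finally show ?thesis .
  qed
  have "(\<lambda>n. (1 + 1 / e) * (\<integral>x. (norm (f n x - g x))\<^sup>2 \<partial>M)) \<longlonglongrightarrow> (1 + 1 / e) * 0"
    by (intro tendsto_intros lim)
  then have "\<forall>\<^sub>F n in sequentially. (1 + 1 / e) * (\<integral>x. (norm (f n x - g x))\<^sup>2 \<partial>M) < r / 2"
    using r by (intro order_tendstoD) auto
  then have "\<forall>\<^sub>F n in sequentially. norm ((\<integral>x. (norm (f n x))\<^sup>2 \<partial>M) - G) < r"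
  proof eventually_elim
    case (elim n)
    show ?case using bound[of n] elim eG unfolding real_norm_def by linarith
  qed
  then show "\<exists>N. \<forall>n\<ge>N. norm ((\<integral>x. (norm (f n x))\<^sup>2 \<partial>M) - (\<integral>x. (norm (g x))\<^sup>2 \<partial>M)) < r"
    by (simp add: G_def eventually_sequentially)
qed

section \<open>Slicing the plane, and integrability of compactly supported functions\<close>

lemma nn_integral_lborel_fst:
  fixes F :: "real \<times> real \<Rightarrow> ennreal"
  assumes "F \<in> borel_measurable borel"
  shows "(\<integral>\<^sup>+x. \<integral>\<^sup>+y. F (x, y) \<partial>lborel \<partial>lborel) = (\<integral>\<^sup>+z. F z \<partial>lborel)"
  using assms lborel.nn_integral_fst[of F lborel] by (simp add: lborel_prod)

text \<open>The exterior of a closed ball is open, so a function vanishing there agrees locally with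
  zero and its derivative vanishes as well.\<close>

lemma Cc1_bounded_support:
  assumes "Cc1 \<phi> D"
  shows "\<exists>R. \<forall>z. R < norm z \<longrightarrow> \<phi> z = 0 \<and> D z = (\<lambda>v. 0)"
proof -
  have der: "(\<phi> has_derivative D z) (at z)" 
    and bdd: "bounded {z. \<phi> z \<noteq> 0}" for z
    using assms unfolding Cc1_def by blast+
  obtain R where R: "\<forall>z\<in>{z. \<phi> z \<noteq> 0}. norm z \<le> R"
    using bdd unfolding bounded_pos by blast
  have supp: "\<phi> z = 0" if "R < norm z" for z
    using R that leD by blast
  have D0: "D z = (\<lambda>v. 0)" if z: "R < norm z" for z
  proof -
    have "open {z :: real \<times> real. R < norm z}"
      by (intro open_Collect_less continuous_intros)
    then have "((\<lambda>_. 0) has_derivative D z) (at z)"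
      using has_derivative_transform_within_open[OF der, of "{z. R < norm z}" z "\<lambda>_. 0"] z supp by simp
    then show ?thesis
      using has_derivative_const by (rule has_derivative_unique)
  qed
  show ?thesis using supp D0 by blast
qed

lemma continuous_bounded_support_L2:
  fixes f :: "'a::euclidean_space \<Rightarrow> complex"
  assumes cont: "continuous_on UNIV f" and supp: "\<And>z. R < norm z \<Longrightarrow> f z = 0"
  shows "f \<in> borel_measurable borel" "integrable lborel (\<lambda>z. (norm (f z))\<^sup>2)"
proof -
  show "f \<in> borel_measurable borel" using cont by (rule borel_measurable_continuous_onI)
  have "integrable lborel (\<lambda>z. indicator (cball 0 R) z *\<^sub>R (norm (f z))\<^sup>2)"
    by (intro borel_integrable_compact continuous_intros continuous_on_subset[OF cont]) auto
  moreover have "(\<lambda>z. indicator (cball 0 R) z *\<^sub>R (norm (f z))\<^sup>2) = (\<lambda>z. (norm (f z))\<^sup>2)"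
    using supp by (force simp: indicator_def)
  ultimately show "integrable lborel (\<lambda>z. (norm (f z))\<^sup>2)" by metis
qed

lemma Cc1_L2:
  assumes "Cc1 \<phi> D"
  shows "L2 \<phi>" and "L2 (\<lambda>z. D z (0, 1))"
    and "(\<lambda>s. \<phi> (\<bar>s\<bar>, s)) \<in> borel_measurable borel"
    and "integrable lborel (\<lambda>s. (cmod (\<phi> (\<bar>s\<bar>, s)))\<^sup>2)"
proof -
  obtain R where "\<forall>z. R < norm z \<longrightarrow> \<phi> z = 0 \<and> D z = (\<lambda>v. 0)"
    using Cc1_bounded_support[OF assms] ..
  then have R: "\<phi> z = 0" "D z = (\<lambda>v. 0)" if "R < norm z" for z
    using that by blast+
  have cont: "continuous_on UNIV \<phi>"
    using assms unfolding Cc1_def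
    by (auto intro!: continuous_at_imp_continuous_on intro: has_derivative_continuous)
  have contD: "continuous_on UNIV (\<lambda>z. D z (0, 1))"
    using assms unfolding Cc1_def by blast
  show "L2 \<phi>" "L2 (\<lambda>z. D z (0, 1))"
    unfolding L2_def
    using continuous_bounded_support_L2[OF cont R(1)] continuous_bounded_support_L2[OF contD, of R] R(2)
    by auto
  have contt: "continuous_on UNIV (\<lambda>s. \<phi> (\<bar>s\<bar>, s))"
    by (intro continuous_on_compose2[OF cont] continuous_intros) auto
  have "\<phi> (\<bar>s\<bar>, s) = 0" if "R < norm s" for s
  proof (rule R(1))
    have "norm s \<le> norm (\<bar>s\<bar>, s)" using norm_snd_le[of s "\<bar>s\<bar>"] by simp
    with that show "R < norm (\<bar>s\<bar>, s)" by simp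
  qed
  then show "(\<lambda>s. \<phi> (\<bar>s\<bar>, s)) \<in> borel_measurable borel"
    and "integrable lborel (\<lambda>s. (cmod (\<phi> (\<bar>s\<bar>, s)))\<^sup>2)"
    using continuous_bounded_support_L2[OF contt, of R] by auto
qed

lemma Pi0_borel_measurable:
  assumes "\<psi> \<in> borel_measurable borel"
  shows "Pi0 \<psi> \<in> borel_measurable borel"
proof -
  have [measurable]: "\<psi> \<in> borel_measurable (borel \<Otimes>\<^sub>M borel)" using assms by (simp add: borel_prod)
  have "Pi0 \<psi> \<in> borel_measurable (borel \<Otimes>\<^sub>M borel)"
    unfolding Pi0_def by measurable
  then show ?thesis by (simp add: borel_prod)
qed

lemma nn_integral_L2sq:
  assumes "L2 f"
  shows "(\<integral>\<^sup>+z. ennreal ((cmod (f z))\<^sup>2) \<partial>lborel) = ennreal (L2sq f)"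
  using assms unfolding L2_def L2sq_def by (intro nn_integral_eq_integral) auto

section \<open>Defect of the projection in the plane\<close>

text \<open>
  The projection is applied only to \<open>\<psi>\<close>: each slice of \<open>\<psi>\<close> is compared with the multiple of
  \<open>e\<^sup>-\<^sup>|\<^sup>y\<^sup>|\<close> read off from the slice of \<open>\<phi>\<close>, so linearity of \<^const>\<open>Pi0\<close> (which fails on
  non-integrable slices) is not needed.
\<close>

lemma Pi0_defect_bound:
  assumes \<psi>: "L2 \<psi>" and \<phi>: "Cc1 \<phi> D"
  shows "L2sq (\<lambda>z. \<psi> z - Pi0 \<psi> z) + 4 * (\<integral>s. (cmod (\<phi> (\<bar>s\<bar>, s)))\<^sup>2 \<partial>lborel)
    \<le> 2 * L2sq (\<lambda>z. \<phi> z - \<psi> z) + 4 * (L2sq (\<lambda>z. D z (0, 1)) + L2sq \<phi>)"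
proof -
  let ?D = "\<lambda>z. D z (0, 1)"
  obtain R where "\<forall>z. R < norm z \<longrightarrow> \<phi> z = 0 \<and> D z = (\<lambda>v. 0)"
    using Cc1_bounded_support[OF \<phi>] ..
  then have R: "\<phi> z = 0" if "R < norm z" for z
    using that by blast
  have [measurable]: "\<psi> \<in> borel_measurable borel" "\<phi> \<in> borel_measurable borel" "?D \<in> borel_measurable borel"
    using \<psi> Cc1_L2(1,2)[OF \<phi>] by (simp_all add: L2_def)
  then have [measurable]: "\<psi> \<in> borel_measurable (borel \<Otimes>\<^sub>M borel)" "\<phi> \<in> borel_measurable (borel \<Otimes>\<^sub>M borel)"
    by (simp_all add: borel_prod)
  have [measurable]: "Pi0 \<psi> \<in> borel_measurable borel"
    by (rule Pi0_borel_measurable) simp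
  have der: "(\<phi> has_derivative D z) (at z)" and contD: "continuous_on UNIV ?D" for z
    using \<phi> unfolding Cc1_def by blast+
  have slice_int: "(\<lambda>x. \<integral>\<^sup>+y. F (x, y) \<partial>lborel) \<in> borel_measurable borel"
    if "F \<in> borel_measurable borel" for F :: "real \<times> real \<Rightarrow> ennreal"
    using lborel.borel_measurable_nn_integral_fst[of F borel] that by (simp add: borel_prod)
  define P where "P = (\<lambda>z. ennreal ((cmod (\<psi> z - Pi0 \<psi> z))\<^sup>2))"
  define d where "d = (\<lambda>z. ennreal ((cmod (\<phi> z - \<psi> z))\<^sup>2))"
  define w where "w = (\<lambda>z. ennreal ((cmod (?D z))\<^sup>2 + (cmod (\<phi> z))\<^sup>2))"
  define t where "t = (\<lambda>s. ennreal ((cmod (\<phi> (\<bar>s\<bar>, s)))\<^sup>2))"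
  have [measurable]: "P \<in> borel_measurable borel" "d \<in> borel_measurable borel" "w \<in> borel_measurable borel"
    unfolding P_def d_def w_def by measurable
  have [measurable]: "t \<in> borel_measurable borel"
    using Cc1_L2(3)[OF \<phi>] unfolding t_def by measurable
  have [measurable]: "(\<lambda>x. \<integral>\<^sup>+y. P (x, y) \<partial>lborel) \<in> borel_measurable borel"
    "(\<lambda>x. \<integral>\<^sup>+y. d (x, y) \<partial>lborel) \<in> borel_measurable borel"
    "(\<lambda>x. \<integral>\<^sup>+y. w (x, y) \<partial>lborel) \<in> borel_measurable borel"
    by (simp_all add: slice_int)
  \<comment> \<open>The slice bound has factor 2, and passing from \<open>\<phi>\<close> to
    \<open>\<psi>\<close> doubles it; this gives both constants 4. The values \<open>t x\<close> and
    \<open>t (- x)\<close> are those of \<open>\<phi>\<close> at the two points of the curve on this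
    slice.\<close>
  have slice_bound: "(\<integral>\<^sup>+y. P (x, y) \<partial>lborel) + 4 * ((t x + t (- x)) * indicator {0..} x)
      \<le> 2 * (\<integral>\<^sup>+y. d (x, y) \<partial>lborel) + 4 * (\<integral>\<^sup>+y. w (x, y) \<partial>lborel)" for x
  proof -
    define c where "c = (if 0 \<le> x then \<phi> (x, 0) else 0)"
    let ?e = "\<lambda>y::real. complex_of_real (exp (- \<bar>y\<bar>))"
    let ?q = "\<lambda>y. ennreal ((cmod (\<phi> (x, y) - c * ?e y))\<^sup>2)"
    let ?u = "ennreal (2 * (cmod (\<phi> (x, x)))\<^sup>2 + 2 * (cmod (\<phi> (x, - x)))\<^sup>2) * indicator {0..} x"
    have trace: "(\<integral>\<^sup>+y. ?q y \<partial>lborel) + ?u \<le> 2 * (\<integral>\<^sup>+y. w (x, y) \<partial>lborel)"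
      unfolding w_def c_def
    proof (rule line_trace_bound)
      fix y :: real
      have "((\<lambda>y. (x, y)) has_derivative (\<lambda>v. (0, v))) (at y)"
        by (auto intro!: derivative_eq_intros)
      from has_derivative_compose[OF this der[of "(x, y)"]]
      have "((\<lambda>y. \<phi> (x, y)) has_derivative (\<lambda>v. D (x, y) (0, v))) (at y)" .
      moreover have "(\<lambda>v. D (x, y) (0, v)) = (\<lambda>v. v *\<^sub>R D (x, y) (0, 1))"
      proof
        fix v
        show "D (x, y) (0, v) = v *\<^sub>R D (x, y) (0, 1)"
          using linear_scale[OF has_derivative_linear[OF der], of "(x, y)" v "(0, 1)"] by simp
      qed
      ultimately show "((\<lambda>y. \<phi> (x, y)) has_vector_derivative D (x, y) (0, 1)) (at y)"
        unfolding has_vector_derivative_def by (rule subst[rotated])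
    next
      show "continuous_on UNIV (\<lambda>y. D (x, y) (0, 1))"
        by (intro continuous_on_compose2[OF contD, of UNIV "\<lambda>y. (x, y)"] continuous_intros) auto
    next
      \<comment> \<open>The shift to \<open>R + 1\<close> turns the non-strict bound of
        \<open>line_trace_bound\<close> into the strict one required by \<open>R\<close>.\<close>
      fix y assume "R + 1 \<le> \<bar>y\<bar>"
      moreover have "\<bar>y\<bar> \<le> norm (x, y)" using norm_snd_le[of y x] by simp
      ultimately show "\<phi> (x, y) = 0" by (intro R) simp
    qed
    have "(\<integral>\<^sup>+y. P (x, y) \<partial>lborel) \<le> (\<integral>\<^sup>+y. ennreal ((cmod (\<psi> (x, y) - c * ?e y))\<^sup>2) \<partial>lborel)"
      unfolding P_def Pi0_def using projection_minimizes[of "\<lambda>y. \<psi> (x, y)" c] by simp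
    also have "\<dots> \<le> (\<integral>\<^sup>+y. 2 * d (x, y) + 2 * ?q y \<partial>lborel)"
    proof (rule nn_integral_mono)
      fix y
      \<comment> \<open>Applied with \<open>p\<close> the value of \<open>\<phi>\<close>, inserted
        between the value of \<open>\<psi>\<close> and the multiple of the profile.\<close>
      have "(cmod (a - b))\<^sup>2 \<le> 2 * (cmod (p - a))\<^sup>2 + 2 * (cmod (p - b))\<^sup>2" for a b p
        using norm_square_diff_le_double[of "p - b" "p - a"] by simp
      then show "ennreal ((cmod (\<psi> (x, y) - c * ?e y))\<^sup>2) \<le> 2 * d (x, y) + 2 * ?q y"
        unfolding d_def
        by (simp flip: ennreal_plus ennreal_numeral ennreal_mult add: ennreal_leI)
    qed
    also have "\<dots> = 2 * (\<integral>\<^sup>+y. d (x, y) \<partial>lborel) + 2 * (\<integral>\<^sup>+y. ?q y \<partial>lborel)"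
      unfolding d_def by (simp add: nn_integral_add nn_integral_cmult)
    finally have "(\<integral>\<^sup>+y. P (x, y) \<partial>lborel) + 2 * ?u
        \<le> 2 * (\<integral>\<^sup>+y. d (x, y) \<partial>lborel) + 2 * ((\<integral>\<^sup>+y. ?q y \<partial>lborel) + ?u)"
      unfolding distrib_left add.assoc[symmetric] by (rule add_right_mono)
    also have "\<dots> \<le> 2 * (\<integral>\<^sup>+y. d (x, y) \<partial>lborel) + 2 * (2 * (\<integral>\<^sup>+y. w (x, y) \<partial>lborel))"
      by (intro add_left_mono mult_left_mono trace) auto
    also have "2 * ?u = 4 * ((t x + t (- x)) * indicator {0..} x)"
    proof (cases "0 \<le> x")
      case True
      then show ?thesis
        unfolding t_def by (simp flip: ennreal_plus ennreal_numeral ennreal_mult)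
    qed simp
    finally show ?thesis by (simp flip: mult.assoc)
  qed
  have "(\<integral>\<^sup>+x. (\<integral>\<^sup>+y. P (x, y) \<partial>lborel) + 4 * ((t x + t (- x)) * indicator {0..} x) \<partial>lborel)
      \<le> (\<integral>\<^sup>+x. 2 * (\<integral>\<^sup>+y. d (x, y) \<partial>lborel) + 4 * (\<integral>\<^sup>+y. w (x, y) \<partial>lborel) \<partial>lborel)"
    by (rule nn_integral_mono) (rule slice_bound)
  also have "\<dots> = 2 * (\<integral>\<^sup>+z. d z \<partial>lborel) + 4 * (\<integral>\<^sup>+z. w z \<partial>lborel)"
    by (simp add: nn_integral_add nn_integral_cmult nn_integral_lborel_fst[of d] nn_integral_lborel_fst[of w])
  \<comment> \<open>Integrating the two traces over nonnegative \<open>x\<close> recovers the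
    integral over the whole curve.\<close>
  also have "(\<integral>\<^sup>+x. (\<integral>\<^sup>+y. P (x, y) \<partial>lborel) + 4 * ((t x + t (- x)) * indicator {0..} x) \<partial>lborel)
      = (\<integral>\<^sup>+z. P z \<partial>lborel) + 4 * (\<integral>\<^sup>+s. t s \<partial>lborel)"
    unfolding nn_integral_lborel_split_reflect[of t, simplified]
    by (simp add: nn_integral_add nn_integral_cmult nn_integral_lborel_fst[of P] distrib_right)
  finally have main: "(\<integral>\<^sup>+z. P z \<partial>lborel) + 4 * (\<integral>\<^sup>+s. t s \<partial>lborel)
      \<le> 2 * (\<integral>\<^sup>+z. d z \<partial>lborel) + 4 * (\<integral>\<^sup>+z. w z \<partial>lborel)" .
  have "L2 (\<lambda>z. \<phi> z - \<psi> z)"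
    using \<psi> Cc1_L2(1)[OF \<phi>] by (auto simp: L2_def intro!: integrable_norm_square_diff)
  then have d: "(\<integral>\<^sup>+z. d z \<partial>lborel) = ennreal (L2sq (\<lambda>z. \<phi> z - \<psi> z))"
    unfolding d_def by (rule nn_integral_L2sq)
  have w: "(\<integral>\<^sup>+z. w z \<partial>lborel) = ennreal (L2sq ?D + L2sq \<phi>)"
    unfolding w_def using Cc1_L2(1,2)[OF \<phi>]
    by (simp add: nn_integral_add nn_integral_L2sq L2sq_def)
  have t: "(\<integral>\<^sup>+s. t s \<partial>lborel) = ennreal (\<integral>s. (cmod (\<phi> (\<bar>s\<bar>, s)))\<^sup>2 \<partial>lborel)"
    unfolding t_def by (intro nn_integral_eq_integral Cc1_L2(4)[OF \<phi>]) auto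
  have nonneg: "0 \<le> L2sq f" for f by (simp add: L2sq_def)
  define K where "K = 2 * L2sq (\<lambda>z. \<phi> z - \<psi> z) + 4 * (L2sq ?D + L2sq \<phi>)"
  have K: "2 * (\<integral>\<^sup>+z. d z \<partial>lborel) + 4 * (\<integral>\<^sup>+z. w z \<partial>lborel) = ennreal K"
    unfolding d w K_def using nonneg
    by (simp flip: ennreal_plus ennreal_numeral ennreal_mult)
  \<comment> \<open>Finiteness must come first: \<open>L2sq\<close> is a Bochner integral, with
    value \<open>0\<close> on non-integrable functions, so only integrability identifies it with the
    integral of \<open>P\<close>.\<close>
  have "(\<integral>\<^sup>+z. P z \<partial>lborel) \<noteq> \<infinity>"
    using main unfolding K by (auto simp: top_unique)
  then have "integrable lborel (\<lambda>z. (cmod (\<psi> z - Pi0 \<psi> z))\<^sup>2)"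
    unfolding P_def by (intro integrableI_nonneg) (auto simp: top.not_eq_extremum)
  then have P: "(\<integral>\<^sup>+z. P z \<partial>lborel) = ennreal (L2sq (\<lambda>z. \<psi> z - Pi0 \<psi> z))"
    unfolding P_def by (intro nn_integral_L2sq) (simp add: L2_def)
  have "ennreal (L2sq (\<lambda>z. \<psi> z - Pi0 \<psi> z) + 4 * (\<integral>s. (cmod (\<phi> (\<bar>s\<bar>, s)))\<^sup>2 \<partial>lborel)) \<le> ennreal K"
    using main nonneg unfolding K unfolding P t
    by (simp flip: ennreal_plus ennreal_numeral ennreal_mult)
  moreover have "0 \<le> K" using nonneg by (simp add: K_def)
  ultimately show ?thesis by (simp add: K_def)
qed

text \<open>\<open>Pi0_defect_bound\<close> is applied along the approximating sequence. The defect
  of \<open>\<psi>\<close> is constant in \<open>n\<close>, the approximation error vanishes, and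
  the remaining terms are squared norms converging to those of \<open>\<psi>\<close>,
  \<open>gy\<close> and \<open>t\<close>.\<close>

lemma H1_data_Pi0_defect_bound:
  assumes "H1_data \<psi> gx gy t"
  shows "L2sq (\<lambda>z. \<psi> z - Pi0 \<psi> z)
    \<le> 4 * (L2sq gy + L2sq \<psi> - (\<integral>s. (cmod (t s))\<^sup>2 \<partial>lborel))"
proof -
  obtain \<phi> D where Cc1: "\<And>n. Cc1 (\<phi> n) (D n)"
    and l\<phi>: "(\<lambda>n. L2sq (\<lambda>z. \<phi> n z - \<psi> z)) \<longlonglongrightarrow> 0"
    and lD: "(\<lambda>n. L2sq (\<lambda>z. D n z (0,1) - gy z)) \<longlonglongrightarrow> 0"
    and lt: "(\<lambda>n. \<integral>s. (cmod (\<phi> n (\<bar>s\<bar>, s) - t s))\<^sup>2 \<partial>lborel) \<longlonglongrightarrow> 0"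
    using assms unfolding H1_data_def by blast
  have \<psi>: "L2 \<psi>" and gy: "L2 gy" and t: "t \<in> borel_measurable lborel"
      "integrable lborel (\<lambda>s. (cmod (t s))\<^sup>2)"
    using assms unfolding H1_data_def by blast+
  note L2 = Cc1_L2[OF Cc1]
  have 1: "(\<lambda>n. L2sq (\<phi> n)) \<longlonglongrightarrow> L2sq \<psi>"
    using l\<phi> \<psi> L2(1) unfolding L2sq_def L2_def by (intro tendsto_integral_norm_square) auto
  have 2: "(\<lambda>n. L2sq (\<lambda>z. D n z (0,1))) \<longlonglongrightarrow> L2sq gy"
    using lD gy L2(2) unfolding L2sq_def L2_def by (intro tendsto_integral_norm_square) auto
  have 3: "(\<lambda>n. \<integral>s. (cmod (\<phi> n (\<bar>s\<bar>, s)))\<^sup>2 \<partial>lborel) \<longlonglongrightarrow> (\<integral>s. (cmod (t s))\<^sup>2 \<partial>lborel)"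
    using lt t L2(3,4) by (intro tendsto_integral_norm_square) auto
  have "(\<lambda>n. 2 * L2sq (\<lambda>z. \<phi> n z - \<psi> z) + 4 * (L2sq (\<lambda>z. D n z (0, 1)) + L2sq (\<phi> n))
        - 4 * (\<integral>s. (cmod (\<phi> n (\<bar>s\<bar>, s)))\<^sup>2 \<partial>lborel))
      \<longlonglongrightarrow> 2 * 0 + 4 * (L2sq gy + L2sq \<psi>) - 4 * (\<integral>s. (cmod (t s))\<^sup>2 \<partial>lborel)"
    by (intro tendsto_intros l\<phi> 1 2 3)
  then have "L2sq (\<lambda>z. \<psi> z - Pi0 \<psi> z)
      \<le> 2 * 0 + 4 * (L2sq gy + L2sq \<psi>) - 4 * (\<integral>s. (cmod (t s))\<^sup>2 \<partial>lborel)"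
    by (rule LIMSEQ_le_const) (use Pi0_defect_bound[OF \<psi> Cc1] in \<open>auto simp: algebra_simps\<close>)
  then show ?thesis by simp
qed

section \<open>Energy identity and conclusion\<close>

lemma integral_mult_cnj_self:
  fixes f :: "'a \<Rightarrow> complex"
  shows "(\<integral>z. f z * cnj (f z) \<partial>M) = complex_of_real (\<integral>z. (cmod (f z))\<^sup>2 \<partial>M)"
  by (simp add: complex_norm_square[symmetric] flip: integral_complex_of_real of_real_power)

text \<open>The weak equation is tested with \<open>\<psi>\<close> together with the same
  \<open>gx\<close>, \<open>gy\<close>, \<open>t\<close> that witness the eigenpair, so every
  sesquilinear term becomes a squared norm.\<close>

lemma eigenpair_energy:
  assumes "eigenpair h E \<psi>"
  obtains gx gy t where "H1_data \<psi> gx gy t"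
    "h\<^sup>2 * L2sq gx + L2sq gy - (\<integral>s. (cmod (t s))\<^sup>2 \<partial>lborel) = E * L2sq \<psi>"
proof -
  obtain gx gy t where H: "H1_data \<psi> gx gy t"
    and "complex_of_real (h\<^sup>2) * (\<integral>z. gx z * cnj (gx z) \<partial>lborel)
          + (\<integral>z. gy z * cnj (gy z) \<partial>lborel)
          - (\<integral>s. t s * cnj (t s) \<partial>lborel)
          = complex_of_real E * (\<integral>z. \<psi> z * cnj (\<psi> z) \<partial>lborel)"
    using assms unfolding eigenpair_def by blast
  then have "complex_of_real (h\<^sup>2 * L2sq gx + L2sq gy - (\<integral>s. (cmod (t s))\<^sup>2 \<partial>lborel))
      = complex_of_real (E * L2sq \<psi>)"
    unfolding integral_mult_cnj_self L2sq_def by simp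
  with H that show ?thesis unfolding of_real_eq_iff by blast
qed

theorem mainTheorem4:
  fixes C0 :: real
  assumes "C0 > 0"
  shows "\<exists>h0>0. \<exists>C>0. \<forall>h E \<psi>. 0 < h \<and> h < h0 \<and> eigenpair h E \<psi>
           \<and> E \<le> -1 + C0 * h powr (2/3) \<longrightarrow>
           L2sq (\<lambda>z. \<psi> z - Pi0 \<psi> z) \<le> C * h powr (2/3) * L2sq \<psi>"
proof (intro exI conjI allI impI)
  fix h E \<psi>
  \<comment> \<open>The witness for \<open>h0\<close> is \<open>1\<close>, an arbitrary choice. The
    witness for \<open>C\<close> is \<open>4 * C0\<close>, where 4 is the constant of
    \<open>H1_data_Pi0_defect_bound\<close> and \<open>C0\<close> bounds \<open>E + 1\<close>
    relative to \<open>h powr (2/3)\<close>.\<close>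
  assume asm: "0 < h \<and> h < 1 \<and> eigenpair h E \<psi> \<and> E \<le> -1 + C0 * h powr (2/3)"
  then obtain gx gy t where H: "H1_data \<psi> gx gy t"
    and energy: "h\<^sup>2 * L2sq gx + L2sq gy - (\<integral>s. (cmod (t s))\<^sup>2 \<partial>lborel) = E * L2sq \<psi>"
    using eigenpair_energy by blast
  have "0 \<le> h\<^sup>2 * L2sq gx" by (simp add: L2sq_def)
  then have "L2sq gy + L2sq \<psi> - (\<integral>s. (cmod (t s))\<^sup>2 \<partial>lborel) \<le> (E + 1) * L2sq \<psi>"
    using energy by (simp add: algebra_simps)
  also have "\<dots> \<le> C0 * h powr (2/3) * L2sq \<psi>"
    using asm by (intro mult_right_mono) (auto simp: L2sq_def)
  finally show "L2sq (\<lambda>z. \<psi> z - Pi0 \<psi> z) \<le> 4 * C0 * h powr (2/3) * L2sq \<psi>"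
    using H1_data_Pi0_defect_bound[OF H] by simp
qed (use assms in auto)

end
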